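(* Let $R\cong F_1\times\cdots\times F_k\times R_{k+1}\times\cdots\times R_n$ be an Artinian ring with $1\le k\le n$ and $n\ge 2$, where each $F_i$ ($1\le i\le k$) is a field and each $R_j$ ($k+1\le j\le n$) is a non-reduced Artinian local commutative ring. Then for every $i\in T$, the set $Z(R)^*\setminus H_i$ is a minimum cut-set of $W\Gamma(R)$. If $R$ is finite, then $$\kappa(W\Gamma(R))=|Z(R)^*|-\theta_{\max}=\delta(W\Gamma(R)).$$
   Context: Weakly zero-divisor graph: for a commutative ring $R$ with identity, $Z(R)$ is the set of zero-divisors (elements $x$ with $xy=0$ for some $y\ne 0$), $Z(R)^*=Z(R)\setminus\{0\}$, and $\mathrm{ann}(x)=\{r\in R: rx=0\}$. $W\Gamma(R)$ is the simple undirected graph with vertex set $Z(R)^*$ in which two distinct vertices $x,y$ are adjacent if and only if there exist nonzero $w\in\mathrm{ann}(x)$ and nonzero $z\in\mathrm{ann}(y)$ with $wz=0$. Sets $H_i$: elements of $R$ are written $x=(x_1,\dots,x_n)$ and $U(R_j)$ denotes the units of $R_j$. For $1\le i\le k$, $H_i$ is the set of all $x\in R$ with $x_i=0$, $x_l\ne 0$ for all $l\in\{1,\dots,k\}\setminus\{i\}$, and $x_j\in U(R_j)$ for all $k+1\le j\le n$. Put $\theta_{\max}:=\max\{|H_i|:1\le i\le k\}$ and $T:=\{i:1\le i\le k,\ |H_i|=\theta_{\max}\}$. Graph notions: a cut-set of a connected graph $\Gamma$ is a set $A\subseteq V(\Gamma)$ such that there are distinct vertices $x,y\in V(\Gamma)\setminus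 A$ with every path from $x$ to $y$ meeting $A$, and no proper subset of $A$ has this property. A cut-set $A$ is minimum if $|A|\le|B|$ for every cut-set $B$. $\kappa(\Gamma)$ (vertex connectivity) is the cardinality of a minimum cut-set. $\deg(v)$ is the cardinality of the set of neighbours of $v$, and $\delta(\Gamma)=\min\{\deg(v): v\in V(\Gamma)\}$.
   Formalization: The minimum cut-set claim and the formula for κ are stated only when some factor does not have exactly two elements; for R = F_2^n the graph is complete, has no cut-set, and κ is undefined. The equality |Z(R)^*| − θ_max = δ is stated for all finite R. *)

theory Defs
  imports
    "HOL-Algebra.Algebra"
    "HOL-Library.Equipollence"
    "Graph_Theory.Graph_Theory"
begin

section \<open>Commutative rings\<close>

locale artinian_cring = cring +
  assumes descending_chain_condition:
    "\<lbrakk>\<And>m::nat. ideal (I m) R; \<And>m. I (Suc m) \<subseteq> I m\<rbrakk> \<Longrightarrow> \<exists>N. \<forall>m\<ge>N. I m = I N"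

locale local_cring = cring +
  assumes ex1_maximalideal: "\<exists>!M. maximalideal M R"

definition reduced_ring :: "('a, 'm) ring_scheme \<Rightarrow> bool" where
  "reduced_ring R \<longleftrightarrow>
    (\<forall>x \<in> carrier R. \<forall>m::nat. x [^]\<^bsub>R\<^esub> m = \<zero>\<^bsub>R\<^esub> \<longrightarrow> x = \<zero>\<^bsub>R\<^esub>)"

definition zero_divisors :: "('a, 'm) ring_scheme \<Rightarrow> 'a set" where
  "zero_divisors R =
    {x \<in> carrier R. \<exists>y \<in> carrier R. y \<noteq> \<zero>\<^bsub>R\<^esub> \<and> x \<otimes>\<^bsub>R\<^esub> y = \<zero>\<^bsub>R\<^esub>}"

definition nonzero_zero_divisors :: "('a, 'm) ring_scheme \<Rightarrow> 'a set" where
  "nonzero_zero_divisors R = zero_divisors R - {\<zero>\<^bsub>R\<^esub>}"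

definition ann :: "('a, 'm) ring_scheme \<Rightarrow> 'a \<Rightarrow> 'a set" where
  "ann R x = {r \<in> carrier R. r \<otimes>\<^bsub>R\<^esub> x = \<zero>\<^bsub>R\<^esub>}"


section \<open>Simple graphs\<close>

text \<open>
  A simple undirected graph is represented, as in the library, by a pair digraph whose set of arcs
  is symmetric and irreflexive: the edge between \<open>x\<close> and \<open>y\<close> is the pair of arcs \<open>(x, y)\<close>, \<open>(y, x)\<close>.
  The vertex set may be infinite.
\<close>

definition separates :: "'a pair_pre_digraph \<Rightarrow> 'a set \<Rightarrow> bool" where
  "separates G A \<longleftrightarrow>
    (\<exists>x \<in> pverts G - A. \<exists>y \<in> pverts G - A. x \<noteq> y \<and>
      (\<forall>p. vpath p (with_proj G) \<and> hd p = x \<and> last p = y \<longrightarrow> set p \<inter> A \<noteq> {}))"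

definition cut_set :: "'a pair_pre_digraph \<Rightarrow> 'a set \<Rightarrow> bool" where
  "cut_set G A \<longleftrightarrow>
    Digraph_Component.connected (with_proj G) \<and> A \<subseteq> pverts G \<and>
    separates G A \<and> (\<forall>B. B \<subset> A \<longrightarrow> \<not> separates G B)"

text \<open>Cardinalities are compared by \<open>\<lesssim>\<close>, since \<^const>\<open>card\<close> is 0 on infinite sets.\<close>

definition minimum_cut_set :: "'a pair_pre_digraph \<Rightarrow> 'a set \<Rightarrow> bool" where
  "minimum_cut_set G A \<longleftrightarrow> cut_set G A \<and> (\<forall>B. cut_set G B \<longrightarrow> A \<lesssim> B)"

text \<open>
  The three numbers below are meaningful for finite graphs. Moreover, a complete graph has no
  cut-set at all, so its \<open>vertex_connectivity\<close> is unspecified; in particular this is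
  so for the weakly zero-divisor graph of a product of copies of the field with two elements.
\<close>

definition vertex_connectivity :: "'a pair_pre_digraph \<Rightarrow> nat" where
  "vertex_connectivity G = (THE c. \<exists>A. minimum_cut_set G A \<and> c = card A)"

definition degree :: "'a pair_pre_digraph \<Rightarrow> 'a \<Rightarrow> nat" where
  "degree G v = card {u \<in> pverts G. (v, u) \<in> parcs G}"

definition min_degree :: "'a pair_pre_digraph \<Rightarrow> nat" where
  "min_degree G = Min (degree G ` pverts G)"


section \<open>The weakly zero-divisor graph\<close>

definition weakly_zero_divisor_graph :: "('a, 'm) ring_scheme \<Rightarrow> 'a pair_pre_digraph" where
  "weakly_zero_divisor_graph R =
    \<lparr>pverts = nonzero_zero_divisors R,
     parcs = {(x, y). x \<in> nonzero_zero_divisors R \<and> y \<in> nonzero_zero_divisors R \<and> x \<noteq> y \<and>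
       (\<exists>w \<in> ann R x - {\<zero>\<^bsub>R\<^esub>}. \<exists>z \<in> ann R y - {\<zero>\<^bsub>R\<^esub>}. w \<otimes>\<^bsub>R\<^esub> z = \<zero>\<^bsub>R\<^esub>)}\<rparr>"

text \<open>
  Throughout, \<open>\<phi>\<close> is a ring isomorphism from \<open>R\<close> onto the direct product \<^term>\<open>RDirProd_list Rs\<close>,
  so \<^term>\<open>\<phi> x ! i\<close> is the \<open>i\<close>-th coordinate of \<open>x\<close>. Indices start at 0: the fields are the
  factors \<^term>\<open>Rs ! i\<close> with \<^prop>\<open>i < k\<close>, and the non-reduced local rings are those with
  \<^prop>\<open>k \<le> i\<close> and \<^prop>\<open>i < length Rs\<close>.
\<close>

definition H_set ::
  "('a, 'm) ring_scheme \<Rightarrow> ('b, 'c) ring_scheme list \<Rightarrow> ('a \<Rightarrow> 'b list) \<Rightarrow> nat \<Rightarrow> nat \<Rightarrow> 'a set" where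
  "H_set R Rs \<phi> k i =
    {x \<in> carrier R. \<phi> x ! i = \<zero>\<^bsub>Rs ! i\<^esub> \<and>
      (\<forall>l<k. l \<noteq> i \<longrightarrow> \<phi> x ! l \<noteq> \<zero>\<^bsub>Rs ! l\<^esub>) \<and>
      (\<forall>j. k \<le> j \<and> j < length Rs \<longrightarrow> \<phi> x ! j \<in> Units (Rs ! j))}"

text \<open>
  \<open>T_set\<close> consists of the indices \<open>i\<close> whose \<open>H_set\<close> has the largest cardinality, which may be
  infinite; \<open>theta_max\<close> is this cardinality in the case where \<open>R\<close> is finite.
\<close>

definition T_set ::
  "('a, 'm) ring_scheme \<Rightarrow> ('b, 'c) ring_scheme list \<Rightarrow> ('a \<Rightarrow> 'b list) \<Rightarrow> nat \<Rightarrow> nat set" where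
  "T_set R Rs \<phi> k = {i. i < k \<and> (\<forall>j<k. H_set R Rs \<phi> k j \<lesssim> H_set R Rs \<phi> k i)}"

definition theta_max ::
  "('a, 'm) ring_scheme \<Rightarrow> ('b, 'c) ring_scheme list \<Rightarrow> ('a \<Rightarrow> 'b list) \<Rightarrow> nat \<Rightarrow> nat" where
  "theta_max R Rs \<phi> k = Max ((\<lambda>i. card (H_set R Rs \<phi> k i)) ` {..<k})"

end

theory Submission
  imports Defs
begin

text \<open>
  The weakly zero-divisor graph of \<open>R\<close> is complete multipartite: its parts are the sets \<open>H i\<close>, one for
  each field factor, together with single vertices (lemma \<open>arc_iff\<close>). All the claims are then
  statements about complete multipartite graphs.

  To see this, attach to a zero divisor \<open>x\<close> the nonempty set of coordinates at which \<open>x\<close> is not a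
  unit. In each factor there is a nonzero element annihilating every non-unit: \<open>\<one>\<close> in a field, and an
  element of the socle in an Artinian local ring (\<open>artinian_local_socle\<close>). In the non-reduced case
  this element is itself a non-unit, hence squares to zero. So \<open>x\<close> and \<open>y\<close> have annihilators with
  product zero as soon as they fail to be units at two different coordinates, or at a common
  coordinate that is not a field: take socle elements supported there. The only remaining
  possibility is that both fail to be units at exactly one coordinate \<open>i\<close>, the same for both, and
  that this is a field; this means that both lie in \<open>H i\<close>. Their annihilators are then
  concentrated at the field \<open>i\<close>, and nonzero annihilators cannot multiply to zero.

  In a complete multipartite graph two vertices can be separated only if they lie in the same part,
  and then every vertex outside the part is a common neighbour and has to be removed. So the
  cut-sets are exactly the complements of the parts with at least two elements (\<open>cut_set_iff\<close>), and
  the smallest are the complements of the largest parts. This remains true for infinite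
  cardinalities, because parts are disjoint (\<open>complement_lepoll\<close>). Some \<open>H i\<close> has two elements
  unless all factors are fields with two elements (\<open>some_H_not_singleton\<close>). The degree of a vertex is
  the number of vertices outside its part, so the minimum degree is attained on a largest part. This
  holds also if all parts are singletons, where the graph is complete.
\<close>


section \<open>Local rings\<close>

lemma (in cring) nonunit_in_maximalideal:
  assumes x: "x \<in> carrier R" and nu: "x \<notin> Units R"
  shows "\<exists>M. maximalideal M R \<and> x \<in> M"
proof -
  define A where "A = {I. ideal I R \<and> x \<in> I \<and> \<one> \<notin> I}"
  have "\<one> \<notin> PIdl x"
  proof
    assume "\<one> \<in> PIdl x"
    then obtain y where "y \<in> carrier R" "y \<otimes> x = \<one>"
      by (auto simp: cgenideal_def)
    with x nu show False
      by (auto simp: Units_def m_comm)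
  qed
  then have "A \<noteq> {}"
    using cgenideal_ideal[OF x] cgenideal_self[OF x] by (auto simp: A_def)
  moreover have "\<Union>C \<in> A" if "C \<noteq> {}" "subset.chain A C" for C
  proof -
    have "C \<subseteq> A" using that by (simp add: subset_chain_def)
    moreover have "ideal (\<Union>C) R"
    proof -
      have "subset.chain {I. ideal I R} C"
        using that by (auto simp: subset_chain_def A_def)
      then show ?thesis
        using chain_Union_is_ideal[of C] that by simp
    qed
    ultimately show ?thesis
      using that by (auto simp: A_def)
  qed
  ultimately obtain M where M: "M \<in> A" "\<And>J. J \<in> A \<Longrightarrow> M \<subseteq> J \<Longrightarrow> J = M"
    using subset_Zorn_nonempty[of A] by blast
  have "maximalideal M R"
  proof (rule maximalidealI)
    show "ideal M R" "carrier R \<noteq> M" using M by (auto simp: A_def)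
    fix J assume J: "ideal J R" "M \<subseteq> J" "J \<subseteq> carrier R"
    show "J = M \<or> J = carrier R"
    proof (cases "\<one> \<in> J")
      case True
      then show ?thesis using ideal.one_imp_carrier[OF J(1)] by simp
    next
      case False
      then show ?thesis using M J by (auto simp: A_def)
    qed
  qed
  then show ?thesis using M by (auto simp: A_def)
qed

text \<open>
  If \<open>x\<close> and \<open>\<one> \<ominus> x\<close> were both non-units, they would lie in the same maximal ideal, and so would
  their sum \<open>\<one>\<close>.
\<close>

lemma (in local_cring) one_minus_nonunit:
  assumes x: "x \<in> carrier R" and nu: "x \<notin> Units R"
  shows "\<one> \<ominus> x \<in> Units R"
proof (rule ccontr)
  assume "\<one> \<ominus> x \<notin> Units R"
  then obtain M N where M: "maximalideal M R" "x \<in> M" and N: "maximalideal N R" "\<one> \<ominus> x \<in> N"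
    using nonunit_in_maximalideal x nu by (meson minus_closed one_closed)
  then have "M = N" using ex1_maximalideal by blast
  interpret M: maximalideal M R by (rule M)
  have "(\<one> \<ominus> x) \<oplus> x \<in> M"
    using M.a_closed[of "\<one> \<ominus> x" x] M(2) N(2) \<open>M = N\<close> by blast
  moreover have "(\<one> \<ominus> x) \<oplus> x = \<one>" using x by algebra
  ultimately show False
    using M.one_imp_carrier M.I_notcarr by simp
qed

lemma (in local_cring) one_not_zero_local: "\<one> \<noteq> \<zero>"
proof
  assume 1: "\<one> = \<zero>"
  obtain M where "maximalideal M R" using ex1_maximalideal by blast
  then interpret M: maximalideal M R .
  show False
    using M.one_imp_carrier M.I_notcarr M.zero_closed 1 by simp
qed

lemma (in cring) nonreduced_has_nonzero_nonunit:
  assumes "\<not> reduced_ring R"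
  shows "\<exists>x \<in> carrier R. x \<noteq> \<zero> \<and> x \<notin> Units R"
proof -
  obtain x and m :: nat where x: "x \<in> carrier R" "x [^] m = \<zero>" "x \<noteq> \<zero>"
    using assms by (auto simp: reduced_ring_def)
  moreover have "x \<notin> Units R"
  proof
    assume "x \<in> Units R"
    then have "\<zero> \<in> Units R"
      using Units_pow_closed x(2) by metis
    then have "\<one> = \<zero>" by (auto simp: Units_def)
    then show False using x one_zeroD by blast
  qed
  ultimately show ?thesis by blast
qed

text \<open>
  An element of the socle serves as a common annihilator of all non-units, which is what makes the
  adjacency relation computable. If no nonzero element were killed by all non-units, one could multiply by non-units
  for ever, obtaining nonzero elements \<open>f (m + 1) = f m \<otimes> x\<close>. The principal ideals of the \<open>f m\<close>
  would stabilise, giving \<open>f m \<otimes> (\<one> \<ominus> r \<otimes> x) = \<zero>\<close> for some \<open>r\<close>, where the second factor is a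
  unit.
\<close>

lemma artinian_local_socle:
  fixes R (structure)
  assumes "artinian_cring R" and "local_cring R"
  shows "\<exists>s \<in> carrier R. s \<noteq> \<zero> \<and> (\<forall>x \<in> carrier R - Units R. s \<otimes> x = \<zero>)"
proof (rule ccontr)
  interpret artinian_cring R by fact
  interpret local_cring R by fact
  assume "\<not> ?thesis"
  then have step: "\<exists>x \<in> carrier R - Units R. s \<otimes> x \<noteq> \<zero>" if "s \<in> carrier R" "s \<noteq> \<zero>" for s
    using that by blast
  have "\<exists>f. \<forall>m::nat. (f m \<in> carrier R \<and> f m \<noteq> \<zero>) \<and>
      (\<exists>x \<in> carrier R - Units R. f (Suc m) = f m \<otimes> x)"
  proof (rule dependent_nat_choice)
    show "\<exists>x. x \<in> carrier R \<and> x \<noteq> \<zero>" using one_not_zero_local by blast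
    show "\<exists>y. (y \<in> carrier R \<and> y \<noteq> \<zero>) \<and> (\<exists>x \<in> carrier R - Units R. y = s \<otimes> x)"
      if "s \<in> carrier R \<and> s \<noteq> \<zero>" for s and m :: nat
      using step[of s] that by blast
  qed
  then obtain f where f: "f m \<in> carrier R" "f m \<noteq> \<zero>"
    "\<exists>x \<in> carrier R - Units R. f (Suc m) = f m \<otimes> x" for m :: nat
    by blast
  have "PIdl (f (Suc m)) \<subseteq> PIdl (f m)" for m
  proof -
    obtain x where x: "x \<in> carrier R" "f (Suc m) = f m \<otimes> x" using f(3)[of m] by blast
    show ?thesis
    proof
      fix y assume "y \<in> PIdl (f (Suc m))"
      then obtain r where "r \<in> carrier R" "y = r \<otimes> (f m \<otimes> x)"
        using x by (auto simp: cgenideal_def)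
      then have "y = (r \<otimes> x) \<otimes> f m" "r \<otimes> x \<in> carrier R"
        using x f(1)[of m] by (simp_all add: m_ac)
      then show "y \<in> PIdl (f m)" by (auto simp: cgenideal_def)
    qed
  qed
  then obtain N where "\<forall>m\<ge>N. PIdl (f m) = PIdl (f N)"
    using descending_chain_condition[of "\<lambda>m. PIdl (f m)"] cgenideal_ideal f(1) by blast
  then have "PIdl (f (Suc N)) = PIdl (f N)"
    by (meson le_Suc_eq order_refl)
  then have "f N \<in> PIdl (f (Suc N))"
    using cgenideal_self[OF f(1)[of N]] by blast
  then obtain r where r: "r \<in> carrier R" "f N = r \<otimes> f (Suc N)"
    by (auto simp: cgenideal_def)
  obtain x where x: "x \<in> carrier R" "x \<notin> Units R" "f (Suc N) = f N \<otimes> x"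
    using f(3)[of N] by blast
  have "r \<otimes> x \<notin> Units R"
    using x r unit_factor[of x r] by (metis m_comm)
  then have u: "\<one> \<ominus> r \<otimes> x \<in> Units R"
    using one_minus_nonunit r x by simp
  have "(\<one> \<ominus> r \<otimes> x) \<otimes> f N = f N \<ominus> r \<otimes> (f N \<otimes> x)"
    using f(1)[of N] r(1) x(1) by algebra
  also have "\<dots> = \<zero>"
    using r x f(1)[of N] by (simp add: r_right_minus_eq)
  also have "\<dots> = (\<one> \<ominus> r \<otimes> x) \<otimes> \<zero>"
    using r(1) x(1) by simp
  finally show False
    using f(1)[of N] f(2)[of N] Units_l_cancel[OF u, of "f N" \<zero>] by simp
qed


section \<open>Complete multipartite graphs\<close>

text \<open>
  Vertices outside every \<open>P i\<close> are adjacent to all other vertices, so they are further parts of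
  size one.
\<close>

locale multipartite_graph =
  fixes G :: "'v pair_pre_digraph" and I :: "'i set" and P :: "'i \<Rightarrow> 'v set"
  assumes parcs_eq: "parcs G = {(x, y). x \<in> pverts G \<and> y \<in> pverts G \<and> x \<noteq> y \<and>
      \<not> (\<exists>i \<in> I. x \<in> P i \<and> y \<in> P i)}"
    and part_subset: "i \<in> I \<Longrightarrow> P i \<subseteq> pverts G"
    and part_disjoint: "\<lbrakk>i \<in> I; j \<in> I; i \<noteq> j\<rbrakk> \<Longrightarrow> P i \<inter> P j = {}"
    and part_nonempty: "i \<in> I \<Longrightarrow> P i \<noteq> {}"
    and part_proper: "i \<in> I \<Longrightarrow> pverts G - P i \<noteq> {}"
    and index_nonempty: "I \<noteq> {}"
begin

lemma adjacent_iff: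
  "\<lbrakk>x \<in> pverts G; y \<in> pverts G; x \<noteq> y\<rbrakk> \<Longrightarrow>
    (x, y) \<in> parcs G \<longleftrightarrow> \<not> (\<exists>i \<in> I. x \<in> P i \<and> y \<in> P i)"
  by (simp add: parcs_eq)

lemma part_unique: "\<lbrakk>i \<in> I; j \<in> I; x \<in> P i; x \<in> P j\<rbrakk> \<Longrightarrow> i = j"
  using part_disjoint by blast

lemma adjacent_across:
  assumes "i \<in> I" "x \<in> P i" "z \<in> pverts G - P i"
  shows "(x, z) \<in> parcs G" "(z, x) \<in> parcs G"
  using assms part_subset[of i] part_unique by (auto simp: parcs_eq)

lemma connected: "Digraph_Component.connected (with_proj G)"
proof -
  have ends: "arcs_ends (with_proj G) = parcs G" by (auto simp: arcs_ends_conv)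
  have "(x, y) \<in> rtrancl_on (pverts G) ((parcs G)\<^sup>s)"
    if xy: "x \<in> pverts G" "y \<in> pverts G" for x y
  proof (cases "x = y \<or> (x, y) \<in> parcs G")
    case True
    then show ?thesis
    proof
      assume "x = y"
      then show ?thesis using xy by simp
    next
      assume "(x, y) \<in> parcs G"
      then have "(x, y) \<in> (parcs G)\<^sup>s" by (simp add: symcl_def)
      then show ?thesis using xy
        by (meson rtrancl_on_refl rtrancl_on_into_rtrancl_on)
    qed
  next
    case False
    then obtain i where i: "i \<in> I" "x \<in> P i" "y \<in> P i"
      using xy adjacent_iff by blast
    obtain z where z: "z \<in> pverts G - P i" using part_proper i by blast
    have "(x, z) \<in> (parcs G)\<^sup>s" "(z, y) \<in> (parcs G)\<^sup>s"
      using adjacent_across[OF i(1) _ z] i by (auto simp: symcl_def)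
    then show ?thesis using xy z
      by (meson DiffD1 rtrancl_on_refl rtrancl_on_into_rtrancl_on)
  qed
  moreover have "pverts G \<noteq> {}"
    using index_nonempty part_proper by blast
  ultimately show ?thesis
    by (simp add: connected_conv ends)
qed

text \<open>
  Two vertices separated by \<open>A\<close> are not adjacent, hence lie in a common part, and all the vertices
  outside this part are common neighbours of the two.
\<close>

lemma separates_iff:
  "separates G A \<longleftrightarrow> (\<exists>i \<in> I. pverts G - P i \<subseteq> A \<and> (\<exists>x \<in> P i - A. \<exists>y \<in> P i - A. x \<noteq> y))"
proof
  assume "separates G A"
  then obtain x y where xy: "x \<in> pverts G" "y \<in> pverts G" "x \<notin> A" "y \<notin> A" "x \<noteq> y"
    and paths: "\<And>p. vpath p (with_proj G) \<Longrightarrow> hd p = x \<Longrightarrow> last p = y \<Longrightarrow> set p \<inter> A \<noteq> {}"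
    by (auto simp: separates_def)
  have "(x, y) \<notin> parcs G"
  proof
    assume "(x, y) \<in> parcs G"
    then have "vpath [x, y] (with_proj G)"
      using xy by (auto simp: vpath_def vwalk_def arcs_ends_conv)
    from paths[OF this] show False using xy by simp
  qed
  then obtain i where i: "i \<in> I" "x \<in> P i" "y \<in> P i"
    using adjacent_iff xy by blast
  have "pverts G - P i \<subseteq> A"
  proof
    fix z assume z: "z \<in> pverts G - P i"
    then have "vpath [x, z, y] (with_proj G)"
      using xy i adjacent_across[OF i(1) _ z] by (auto simp: vpath_def vwalk_def arcs_ends_conv)
    from paths[OF this] show "z \<in> A" using xy by simp
  qed
  with i xy show "\<exists>i \<in> I. pverts G - P i \<subseteq> A \<and> (\<exists>x \<in> P i - A. \<exists>y \<in> P i - A. x \<noteq> y)"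
    by blast
next
  assume "\<exists>i \<in> I. pverts G - P i \<subseteq> A \<and> (\<exists>x \<in> P i - A. \<exists>y \<in> P i - A. x \<noteq> y)"
  then obtain i x y where i: "i \<in> I" "pverts G - P i \<subseteq> A"
    and xy: "x \<in> P i - A" "y \<in> P i - A" "x \<noteq> y"
    by blast
  have "set p \<inter> A \<noteq> {}" if p: "vpath p (with_proj G)" "hd p = x" "last p = y" for p
  proof -
    \<comment> \<open>The second vertex of the path is a neighbour of \<open>x\<close>, so it lies outside the part of \<open>x\<close>.\<close>
    obtain z q where q: "p = x # z # q"
      using p xy by (cases p; cases "tl p") (auto simp: vpath_def vwalk_def)
    then have "(x, z) \<in> parcs G" "z \<in> pverts G"
      using p by (auto simp: vpath_def vwalk_def arcs_ends_conv)
    then have "z \<in> A" using i xy by (auto simp: parcs_eq)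
    with q show ?thesis by auto
  qed
  moreover have "x \<in> pverts G - A" "y \<in> pverts G - A"
    using xy i part_subset[of i] by auto
  ultimately show "separates G A"
    unfolding separates_def using xy(3) by blast
qed

theorem cut_set_iff:
  "cut_set G A \<longleftrightarrow> (\<exists>i \<in> I. A = pverts G - P i \<and> (\<exists>x \<in> P i. \<exists>y \<in> P i. x \<noteq> y))"
proof
  assume A: "cut_set G A"
  then have sep: "separates G A" and min: "\<And>B. B \<subset> A \<Longrightarrow> \<not> separates G B"
    by (auto simp: cut_set_def)
  from sep obtain i x y where i: "i \<in> I" "pverts G - P i \<subseteq> A"
    and xy: "x \<in> P i" "y \<in> P i" "x \<noteq> y"
    by (auto simp: separates_iff)
  then have "separates G (pverts G - P i)"
    by (auto simp: separates_iff)
  then have "A = pverts G - P i" using min i by blast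
  with i xy show "\<exists>i \<in> I. A = pverts G - P i \<and> (\<exists>x \<in> P i. \<exists>y \<in> P i. x \<noteq> y)" by blast
next
  assume "\<exists>i \<in> I. A = pverts G - P i \<and> (\<exists>x \<in> P i. \<exists>y \<in> P i. x \<noteq> y)"
  then obtain i x y where i: "i \<in> I" "A = pverts G - P i"
    and xy: "x \<in> P i" "y \<in> P i" "x \<noteq> y"
    by blast
  then have "separates G A" by (auto simp: separates_iff)
  moreover have "\<not> separates G B" if B: "B \<subset> A" for B
  proof
    assume "separates G B"
    then obtain j where j: "j \<in> I" "pverts G - P j \<subseteq> B" by (auto simp: separates_iff)
    then have "P i \<subseteq> P j" using B i part_subset[of i] by blast
    then have "i = j" using part_unique[of i j] i j xy by blast
    then show False using B i j by blast
  qed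
  ultimately show "cut_set G A"
    using connected i by (auto simp: cut_set_def)
qed

text \<open>
  Distinct parts are disjoint, so their complements arise from a common set by adding the other
  part; thus complements reverse the comparison of sizes even for infinite cardinals.
\<close>

lemma complement_lepoll:
  assumes ij: "i \<in> I" "j \<in> I" and le: "P j \<lesssim> P i"
  shows "pverts G - P i \<lesssim> pverts G - P j"
proof (cases "i = j")
  case True
  then show ?thesis by simp
next
  case False
  then have disj: "P i \<inter> P j = {}" using part_disjoint ij by blast
  let ?W = "pverts G - P i - P j"
  have "P j \<union> ?W \<lesssim> P i \<union> ?W"
    using le by (rule Un_lepoll_mono) (auto simp: disjnt_def)
  moreover have "pverts G - P i = P j \<union> ?W" "pverts G - P j = P i \<union> ?W"
    using disj part_subset ij by blast+
  ultimately show ?thesis by simp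
qed

lemma minimum_cut_setI:
  assumes "i \<in> I" "x \<in> P i" "y \<in> P i" "x \<noteq> y"
    and "\<And>j. j \<in> I \<Longrightarrow> P j \<lesssim> P i"
  shows "minimum_cut_set G (pverts G - P i)"
  using assms complement_lepoll by (auto simp: minimum_cut_set_def cut_set_iff)

lemma vertex_connectivity_eq:
  assumes fin: "finite (pverts G)" and A: "minimum_cut_set G A"
  shows "vertex_connectivity G = card A"
  unfolding vertex_connectivity_def
proof (rule the_equality)
  show "\<exists>B. minimum_cut_set G B \<and> card A = card B" using A by blast
  fix c assume "\<exists>B. minimum_cut_set G B \<and> c = card B"
  then obtain B where B: "minimum_cut_set G B" "c = card B" by blast
  then have "A \<lesssim> B" "B \<lesssim> A" "A \<subseteq> pverts G" "B \<subseteq> pverts G"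
    using A by (auto simp: minimum_cut_set_def cut_set_def)
  then show "c = card A"
    using B fin by (meson antisym finite_subset lepoll_iff_card_le)
qed

lemma degree_in_part:
  assumes "i \<in> I" "v \<in> P i"
  shows "degree G v = card (pverts G - P i)"
proof -
  have "{u \<in> pverts G. (v, u) \<in> parcs G} = pverts G - P i"
    using assms adjacent_across(1)[OF assms] part_subset[of i] by (auto simp: parcs_eq)
  then show ?thesis by (simp add: degree_def)
qed

lemma degree_outside_parts:
  assumes "v \<in> pverts G" "\<And>i. i \<in> I \<Longrightarrow> v \<notin> P i"
  shows "degree G v = card (pverts G) - 1"
proof -
  have "{u \<in> pverts G. (v, u) \<in> parcs G} = pverts G - {v}"
    using assms by (auto simp: parcs_eq)
  then show ?thesis using assms by (simp add: degree_def card_Diff_singleton)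
qed

lemma min_degree_eq:
  assumes fin: "finite (pverts G)" and i: "i \<in> I"
    and max: "\<And>j. j \<in> I \<Longrightarrow> card (P j) \<le> card (P i)"
  shows "min_degree G = card (pverts G) - card (P i)"
  unfolding min_degree_def
proof (rule Min_eqI)
  have part_card: "card (pverts G - P j) = card (pverts G) - card (P j)" if "j \<in> I" for j
    using part_subset[OF that] fin by (meson card_Diff_subset finite_subset)
  have pos: "card (P i) \<ge> 1"
    using part_nonempty[OF i] part_subset[OF i] fin
    by (metis One_nat_def Suc_leI card_gt_0_iff finite_subset)
  show "finite (degree G ` pverts G)" using fin by simp
  obtain v where v: "v \<in> P i" using part_nonempty i by blast
  then have "degree G v = card (pverts G) - card (P i)"
    using degree_in_part i part_card by simp
  then show "card (pverts G) - card (P i) \<in> degree G ` pverts G"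
    using v part_subset[OF i] by (metis imageI subsetD)
  fix d assume "d \<in> degree G ` pverts G"
  then obtain u where u: "u \<in> pverts G" "d = degree G u" by blast
  show "card (pverts G) - card (P i) \<le> d"
  proof (cases "\<exists>j \<in> I. u \<in> P j")
    case True
    then obtain j where j: "j \<in> I" "u \<in> P j" by blast
    then show ?thesis using u degree_in_part[OF j] part_card[OF j(1)] max[OF j(1)] by simp
  next
    case False
    then have "d = card (pverts G) - 1" using u degree_outside_parts by blast
    then show ?thesis using pos by simp
  qed
qed

end


section \<open>Coordinates in a finite direct product\<close>

lemma RDirProd_list_mult_nth:
  assumes "as \<in> carrier (RDirProd_list Rs)" "bs \<in> carrier (RDirProd_list Rs)" "i < length Rs"
  shows "(as \<otimes>\<^bsub>RDirProd_list Rs\<^esub> bs) ! i = as ! i \<otimes>\<^bsub>Rs ! i\<^esub> bs ! i"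
  using assms
proof (induction Rs arbitrary: as bs i)
  case Nil
  then show ?case by simp
next
  case (Cons S Rs)
  obtain a as' b bs' where ab: "as = a # as'" "bs = b # bs'"
    and carr: "a \<in> carrier S" "b \<in> carrier S"
      "as' \<in> carrier (RDirProd_list Rs)" "bs' \<in> carrier (RDirProd_list Rs)"
    using Cons.prems(1,2) unfolding RDirProd_list_carrier by auto
  have "(a # as') \<otimes>\<^bsub>RDirProd_list (S # Rs)\<^esub> (b # bs')
      = (a \<otimes>\<^bsub>S\<^esub> b) # (as' \<otimes>\<^bsub>RDirProd_list Rs\<^esub> bs')"
    using ring_hom_mult[OF RDirProd_list_hom1[of S Rs], of "(a, as')" "(b, bs')"] carr
    by (simp add: RDirProd_carrier RDirProd_def DirProd_def monoid.defs)
  then show ?case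
    using Cons carr ab by (cases i) simp_all
qed

lemma RDirProd_list_zero_nth: "i < length Rs \<Longrightarrow> \<zero>\<^bsub>RDirProd_list Rs\<^esub> ! i = \<zero>\<^bsub>Rs ! i\<^esub>"
proof (induction Rs arbitrary: i)
  case Nil
  then show ?case by simp
next
  case (Cons S Rs)
  then show ?case by (cases i) (simp_all add: RDirProd_list_zero')
qed


section \<open>Products of fields and non-reduced Artinian local rings\<close>

locale field_local_product = cring R for R :: "('a, 'm) ring_scheme" (structure) +
  fixes Rs :: "('b, 'c) ring_scheme list" and \<phi> :: "'a \<Rightarrow> 'b list" and k :: nat
  assumes iso: "\<phi> \<in> ring_iso R (RDirProd_list Rs)"
    and some_field: "1 \<le> k" and field_count: "k \<le> length Rs" and two_factors: "2 \<le> length Rs"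
    and factor_field: "i < k \<Longrightarrow> field (Rs ! i)"
    and factor_local: "\<lbrakk>k \<le> j; j < length Rs\<rbrakk> \<Longrightarrow>
      artinian_cring (Rs ! j) \<and> local_cring (Rs ! j) \<and> \<not> reduced_ring (Rs ! j)"
begin

lemma factor_cring: "i < length Rs \<Longrightarrow> cring (Rs ! i)"
  using factor_field[of i] factor_local[of i]
  by (cases "i < k") (auto simp: artinian_cring_def field_def domain_def)

lemma factor_one_not_zero: "i < length Rs \<Longrightarrow> \<one>\<^bsub>Rs ! i\<^esub> \<noteq> \<zero>\<^bsub>Rs ! i\<^esub>"
proof (cases "i < k")
  case True
  then interpret F: field "Rs ! i" by (rule factor_field)
  show ?thesis by simp
next
  case False
  assume "i < length Rs"
  then show ?thesis
    using False factor_local[of i] local_cring.one_not_zero_local[of "Rs ! i"] by simp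
qed

lemma factor_zero_closed: "i < length Rs \<Longrightarrow> \<zero>\<^bsub>Rs ! i\<^esub> \<in> carrier (Rs ! i)"
  using factor_cring[of i] by (simp add: cring_def ring.ring_simprules)

lemma factor_l_null:
  "\<lbrakk>i < length Rs; x \<in> carrier (Rs ! i)\<rbrakk> \<Longrightarrow> \<zero>\<^bsub>Rs ! i\<^esub> \<otimes>\<^bsub>Rs ! i\<^esub> x = \<zero>\<^bsub>Rs ! i\<^esub>"
proof -
  assume i: "i < length Rs" and x: "x \<in> carrier (Rs ! i)"
  interpret S: cring "Rs ! i" using i by (rule factor_cring)
  show ?thesis using x by (rule S.l_null)
qed

lemma factor_r_null:
  "\<lbrakk>i < length Rs; x \<in> carrier (Rs ! i)\<rbrakk> \<Longrightarrow> x \<otimes>\<^bsub>Rs ! i\<^esub> \<zero>\<^bsub>Rs ! i\<^esub> = \<zero>\<^bsub>Rs ! i\<^esub>"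
proof -
  assume i: "i < length Rs" and x: "x \<in> carrier (Rs ! i)"
  interpret S: cring "Rs ! i" using i by (rule factor_cring)
  show ?thesis using x by (rule S.r_null)
qed

lemma zero_not_unit: "i < length Rs \<Longrightarrow> \<zero>\<^bsub>Rs ! i\<^esub> \<notin> Units (Rs ! i)"
proof
  assume i: "i < length Rs" and u: "\<zero>\<^bsub>Rs ! i\<^esub> \<in> Units (Rs ! i)"
  interpret S: cring "Rs ! i" using i by (rule factor_cring)
  show False
    using u factor_one_not_zero[OF i] by (auto simp: Units_def)
qed

lemma field_Units_iff:
  "\<lbrakk>i < k; x \<in> carrier (Rs ! i)\<rbrakk> \<Longrightarrow> x \<in> Units (Rs ! i) \<longleftrightarrow> x \<noteq> \<zero>\<^bsub>Rs ! i\<^esub>"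
  using field.field_Units[OF factor_field] by blast

lemma coord_carrier: "\<lbrakk>x \<in> carrier R; i < length Rs\<rbrakk> \<Longrightarrow> \<phi> x ! i \<in> carrier (Rs ! i)"
  using iso RDirProd_list_carrier_mem(2) ring_hom_closed unfolding ring_iso_def by fastforce

lemma coord_mult:
  "\<lbrakk>x \<in> carrier R; y \<in> carrier R; i < length Rs\<rbrakk> \<Longrightarrow>
    \<phi> (x \<otimes> y) ! i = \<phi> x ! i \<otimes>\<^bsub>Rs ! i\<^esub> \<phi> y ! i"
  using iso ring_hom_mult[of \<phi>] ring_hom_closed[of \<phi>] RDirProd_list_mult_nth
  unfolding ring_iso_def by fastforce

lemma coord_zero: "i < length Rs \<Longrightarrow> \<phi> \<zero> ! i = \<zero>\<^bsub>Rs ! i\<^esub>"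
proof -
  assume i: "i < length Rs"
  have "ring (RDirProd_list Rs)"
    using RDirProd_list_is_ring factor_cring cring.axioms(1) by blast
  then have "\<phi> \<zero> = \<zero>\<^bsub>RDirProd_list Rs\<^esub>"
    using iso ring_hom_zero[OF _ ring_axioms] unfolding ring_iso_def by blast
  then show ?thesis using i by (simp add: RDirProd_list_zero_nth)
qed

lemma coord_ext:
  assumes "x \<in> carrier R" "y \<in> carrier R" "\<And>i. i < length Rs \<Longrightarrow> \<phi> x ! i = \<phi> y ! i"
  shows "x = y"
proof -
  have bij: "bij_betw \<phi> (carrier R) (carrier (RDirProd_list Rs))"
    using iso unfolding ring_iso_def by blast
  then have "\<phi> x \<in> carrier (RDirProd_list Rs)" "\<phi> y \<in> carrier (RDirProd_list Rs)"
    using assms by (auto simp: bij_betw_def)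
  then have "\<phi> x = \<phi> y"
    using assms(3) by (intro nth_equalityI) (simp_all add: RDirProd_list_carrier_mem(1))
  then show ?thesis
    using bij assms(1,2) by (auto simp: bij_betw_def inj_on_def)
qed

lemma ex_coords:
  assumes "\<And>i. i < length Rs \<Longrightarrow> f i \<in> carrier (Rs ! i)"
  obtains x where "x \<in> carrier R" "\<And>i. i < length Rs \<Longrightarrow> \<phi> x ! i = f i"
proof -
  have "map f [0..<length Rs] \<in> carrier (RDirProd_list Rs)"
    using assms by (intro RDirProd_list_carrier_memI) simp_all
  moreover have "\<phi> ` carrier R = carrier (RDirProd_list Rs)"
    using iso by (auto simp: ring_iso_def bij_betw_def)
  ultimately obtain x where "x \<in> carrier R" "\<phi> x = map f [0..<length Rs]"
    by (metis imageE)
  with that show thesis by simp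
qed

lemma eq_zero_iff: "x \<in> carrier R \<Longrightarrow> x = \<zero> \<longleftrightarrow> (\<forall>i<length Rs. \<phi> x ! i = \<zero>\<^bsub>Rs ! i\<^esub>)"
  using coord_ext[of x \<zero>] coord_zero by auto

lemma mult_eq_zero_iff:
  "\<lbrakk>x \<in> carrier R; y \<in> carrier R\<rbrakk> \<Longrightarrow>
    x \<otimes> y = \<zero> \<longleftrightarrow> (\<forall>i<length Rs. \<phi> x ! i \<otimes>\<^bsub>Rs ! i\<^esub> \<phi> y ! i = \<zero>\<^bsub>Rs ! i\<^esub>)"
  by (simp add: eq_zero_iff coord_mult)

text \<open>
  The set of coordinates at which an element fails to be invertible decides everything about its
  adjacencies.
\<close>

definition nonunit_coords :: "'a \<Rightarrow> nat set" where
  "nonunit_coords x = {i. i < length Rs \<and> \<phi> x ! i \<notin> Units (Rs ! i)}"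

text \<open>
  In a field, \<open>\<one>\<close> annihilates the only non-unit \<open>\<zero>\<close> but has nonzero square; in a non-reduced local
  factor, a socle element is itself a non-unit and hence squares to zero. This difference is why
  only the fields give rise to independent sets.
\<close>

lemma factor_socle:
  assumes i: "i < length Rs"
  obtains s where "s \<in> carrier (Rs ! i)" "s \<noteq> \<zero>\<^bsub>Rs ! i\<^esub>"
    "\<And>x. \<lbrakk>x \<in> carrier (Rs ! i); x \<notin> Units (Rs ! i)\<rbrakk> \<Longrightarrow> s \<otimes>\<^bsub>Rs ! i\<^esub> x = \<zero>\<^bsub>Rs ! i\<^esub>"
    "k \<le> i \<Longrightarrow> s \<otimes>\<^bsub>Rs ! i\<^esub> s = \<zero>\<^bsub>Rs ! i\<^esub>"
proof -
  interpret S: cring "Rs ! i" using i by (rule factor_cring)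
  show thesis
  proof (cases "i < k")
    case True
    show ?thesis
      by (rule that[of "\<one>\<^bsub>Rs ! i\<^esub>"])
        (use True factor_one_not_zero[OF i] field_Units_iff[OF True] in auto)
  next
    case False
    then have loc: "artinian_cring (Rs ! i)" "local_cring (Rs ! i)" "\<not> reduced_ring (Rs ! i)"
      using factor_local i by auto
    obtain s where s: "s \<in> carrier (Rs ! i)" "s \<noteq> \<zero>\<^bsub>Rs ! i\<^esub>"
      "\<And>x. x \<in> carrier (Rs ! i) - Units (Rs ! i) \<Longrightarrow> s \<otimes>\<^bsub>Rs ! i\<^esub> x = \<zero>\<^bsub>Rs ! i\<^esub>"
      using artinian_local_socle[OF loc(1,2)] by blast
    obtain x where x: "x \<in> carrier (Rs ! i)" "x \<noteq> \<zero>\<^bsub>Rs ! i\<^esub>" "x \<notin> Units (Rs ! i)"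
      using S.nonreduced_has_nonzero_nonunit[OF loc(3)] by blast
    have "s \<notin> Units (Rs ! i)"
      using s(3)[of x] x S.Units_l_cancel[of s x "\<zero>\<^bsub>Rs ! i\<^esub>"] s(1) by auto
    then show ?thesis using that[of s] s by blast
  qed
qed

lemma socle_element:
  assumes i: "i < length Rs"
  obtains e where "e \<in> carrier R" "e \<noteq> \<zero>"
    "\<And>j. \<lbrakk>j < length Rs; j \<noteq> i\<rbrakk> \<Longrightarrow> \<phi> e ! j = \<zero>\<^bsub>Rs ! j\<^esub>"
    "\<And>x. \<lbrakk>x \<in> carrier R; i \<in> nonunit_coords x\<rbrakk> \<Longrightarrow> e \<otimes> x = \<zero>"
    "k \<le> i \<Longrightarrow> e \<otimes> e = \<zero>"
proof -
  obtain s where s: "s \<in> carrier (Rs ! i)" "s \<noteq> \<zero>\<^bsub>Rs ! i\<^esub>"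
    "\<And>x. \<lbrakk>x \<in> carrier (Rs ! i); x \<notin> Units (Rs ! i)\<rbrakk> \<Longrightarrow> s \<otimes>\<^bsub>Rs ! i\<^esub> x = \<zero>\<^bsub>Rs ! i\<^esub>"
    "k \<le> i \<Longrightarrow> s \<otimes>\<^bsub>Rs ! i\<^esub> s = \<zero>\<^bsub>Rs ! i\<^esub>"
    using factor_socle[OF i] by blast
  obtain e where e: "e \<in> carrier R"
    "\<And>j. j < length Rs \<Longrightarrow> \<phi> e ! j = (if j = i then s else \<zero>\<^bsub>Rs ! j\<^esub>)"
  proof (rule ex_coords)
    show "(if j = i then s else \<zero>\<^bsub>Rs ! j\<^esub>) \<in> carrier (Rs ! j)" if "j < length Rs" for j
      using that s(1) factor_zero_closed by simp
  qed blast
  show thesis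
  proof (rule that[of e])
    show "e \<in> carrier R" by fact
    show "e \<noteq> \<zero>" using e s(2) i by (auto simp: eq_zero_iff)
    show "\<phi> e ! j = \<zero>\<^bsub>Rs ! j\<^esub>" if "j < length Rs" "j \<noteq> i" for j using e that by simp
    show "e \<otimes> x = \<zero>" if "x \<in> carrier R" "i \<in> nonunit_coords x" for x
      using that e s(3) factor_l_null coord_carrier by (auto simp: mult_eq_zero_iff nonunit_coords_def)
    show "e \<otimes> e = \<zero>" if "k \<le> i"
      using that e s(4) factor_l_null factor_zero_closed by (auto simp: mult_eq_zero_iff)
  qed
qed

lemma unit_mult_eq_zero:
  assumes "i < length Rs" "u \<in> Units (Rs ! i)" "w \<in> carrier (Rs ! i)"
    and "w \<otimes>\<^bsub>Rs ! i\<^esub> u = \<zero>\<^bsub>Rs ! i\<^esub>"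
  shows "w = \<zero>\<^bsub>Rs ! i\<^esub>"
proof -
  interpret S: cring "Rs ! i" using assms(1) by (rule factor_cring)
  have "u \<otimes>\<^bsub>Rs ! i\<^esub> w = u \<otimes>\<^bsub>Rs ! i\<^esub> \<zero>\<^bsub>Rs ! i\<^esub>"
    using assms by (simp add: S.m_comm S.Units_closed)
  then show ?thesis
    using assms S.Units_l_cancel by blast
qed

lemma annihilator_coord_zero:
  assumes "x \<in> carrier R" "w \<in> ann R x" "j < length Rs" "j \<notin> nonunit_coords x"
  shows "\<phi> w ! j = \<zero>\<^bsub>Rs ! j\<^esub>"
  using assms coord_carrier[of w j] unit_mult_eq_zero[of j "\<phi> x ! j" "\<phi> w ! j"]
  by (auto simp: ann_def nonunit_coords_def mult_eq_zero_iff)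

lemma zero_divisors_iff:
  "x \<in> zero_divisors R \<longleftrightarrow> x \<in> carrier R \<and> nonunit_coords x \<noteq> {}"
proof
  assume x: "x \<in> zero_divisors R"
  then obtain y where y: "x \<in> carrier R" "y \<in> carrier R" "y \<noteq> \<zero>" "x \<otimes> y = \<zero>"
    by (auto simp: zero_divisors_def)
  then have "y \<in> ann R x" by (simp add: ann_def m_comm)
  then show "x \<in> carrier R \<and> nonunit_coords x \<noteq> {}"
    using y annihilator_coord_zero[of x y] by (auto simp: eq_zero_iff)
next
  assume x: "x \<in> carrier R \<and> nonunit_coords x \<noteq> {}"
  then obtain i where i: "i < length Rs" "i \<in> nonunit_coords x"
    by (auto simp: nonunit_coords_def)
  obtain e where "e \<in> carrier R" "e \<noteq> \<zero>" "e \<otimes> x = \<zero>"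
    using socle_element[OF i(1)] i(2) x by metis
  then show "x \<in> zero_divisors R"
    using x by (auto simp: zero_divisors_def m_comm)
qed

abbreviation H :: "nat \<Rightarrow> 'a set" where
  "H \<equiv> H_set R Rs \<phi> k"

lemma H_eq:
  assumes i: "i < k"
  shows "H i = {x \<in> carrier R. nonunit_coords x = {i}}"
proof -
  have "(\<phi> x ! i = \<zero>\<^bsub>Rs ! i\<^esub> \<and> (\<forall>l<k. l \<noteq> i \<longrightarrow> \<phi> x ! l \<noteq> \<zero>\<^bsub>Rs ! l\<^esub>) \<and>
      (\<forall>j. k \<le> j \<and> j < length Rs \<longrightarrow> \<phi> x ! j \<in> Units (Rs ! j))) \<longleftrightarrow> nonunit_coords x = {i}"
    (is "?L \<longleftrightarrow> ?R") if x: "x \<in> carrier R" for x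
  proof -
    have unit: "\<phi> x ! l \<in> Units (Rs ! l) \<longleftrightarrow> \<phi> x ! l \<noteq> \<zero>\<^bsub>Rs ! l\<^esub>" if "l < k" for l
      using that x field_count coord_carrier field_Units_iff by simp
    have "?R \<longleftrightarrow> (\<forall>l<length Rs. \<phi> x ! l \<notin> Units (Rs ! l) \<longleftrightarrow> l = i)"
      using i field_count unfolding nonunit_coords_def set_eq_iff by (auto dest: less_le_trans)
    also have "\<dots> \<longleftrightarrow> ?L"
    proof
      assume a: "\<forall>l<length Rs. \<phi> x ! l \<notin> Units (Rs ! l) \<longleftrightarrow> l = i"
      then have "\<phi> x ! l \<notin> Units (Rs ! l) \<longleftrightarrow> l = i" if "l < k" for l
        using that field_count by simp
      then show ?L using a unit i by auto
    next
      assume L: ?L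
      show "\<forall>l<length Rs. \<phi> x ! l \<notin> Units (Rs ! l) \<longleftrightarrow> l = i"
      proof (intro allI impI)
        fix l assume "l < length Rs"
        then show "\<phi> x ! l \<notin> Units (Rs ! l) \<longleftrightarrow> l = i"
          using L unit i by (cases "l < k") auto
      qed
    qed
    finally show ?thesis by simp
  qed
  then show ?thesis unfolding H_set_def by auto
qed

lemma H_subset:
  assumes i: "i < k"
  shows "H i \<subseteq> nonzero_zero_divisors R"
proof
  fix x assume x: "x \<in> H i"
  obtain j where j: "j < length Rs" "j \<noteq> i"
  proof
    show "(if i = 0 then 1 else 0) < length Rs" "(if i = 0 then 1 else 0) \<noteq> i"
      using two_factors by auto
  qed
  have x': "x \<in> carrier R" "nonunit_coords x = {i}"
    using x by (auto simp: H_eq[OF i])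
  have "j \<notin> nonunit_coords x" using j x' by simp
  moreover have "j \<in> nonunit_coords \<zero>"
    using j zero_not_unit by (simp add: nonunit_coords_def coord_zero)
  ultimately have "x \<noteq> \<zero>" by blast
  then show "x \<in> nonzero_zero_divisors R"
    using x' by (simp add: nonzero_zero_divisors_def zero_divisors_iff)
qed

text \<open>
  Within one \<open>H i\<close> all annihilators are concentrated at the field coordinate \<open>i\<close>, where a product
  of nonzero entries is nonzero. Otherwise socle elements supported at two different coordinates,
  or twice at a non-reduced coordinate, have product zero.
\<close>

lemma arc_iff:
  assumes x: "x \<in> nonzero_zero_divisors R" and y: "y \<in> nonzero_zero_divisors R"
  shows "(\<exists>w \<in> ann R x - {\<zero>}. \<exists>z \<in> ann R y - {\<zero>}. w \<otimes> z = \<zero>) \<longleftrightarrow>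
    \<not> (\<exists>i \<in> {..<k}. x \<in> H i \<and> y \<in> H i)"
proof
  assume "\<exists>w \<in> ann R x - {\<zero>}. \<exists>z \<in> ann R y - {\<zero>}. w \<otimes> z = \<zero>"
  then obtain w z where wz: "w \<in> ann R x" "w \<noteq> \<zero>" "z \<in> ann R y" "z \<noteq> \<zero>" "w \<otimes> z = \<zero>"
    by blast
  then have carr: "w \<in> carrier R" "z \<in> carrier R" by (auto simp: ann_def)
  show "\<not> (\<exists>i \<in> {..<k}. x \<in> H i \<and> y \<in> H i)"
  proof
    assume "\<exists>i \<in> {..<k}. x \<in> H i \<and> y \<in> H i"
    then obtain i where i: "i < k" "x \<in> H i" "y \<in> H i" by auto
    then have i': "i < length Rs" using field_count by simp
    interpret F: field "Rs ! i" using i(1) by (rule factor_field)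
    have xy: "x \<in> carrier R" "nonunit_coords x = {i}" "y \<in> carrier R" "nonunit_coords y = {i}"
      using i by (auto simp: H_eq)
    then have "\<phi> w ! i \<noteq> \<zero>\<^bsub>Rs ! i\<^esub>" "\<phi> z ! i \<noteq> \<zero>\<^bsub>Rs ! i\<^esub>"
      using annihilator_coord_zero[of x w] annihilator_coord_zero[of y z] wz carr
      by (auto simp: eq_zero_iff)
    moreover have "\<phi> w ! i \<otimes>\<^bsub>Rs ! i\<^esub> \<phi> z ! i = \<zero>\<^bsub>Rs ! i\<^esub>"
      using wz(5) carr i' by (simp add: mult_eq_zero_iff)
    ultimately show False
      using F.integral coord_carrier carr i' by blast
  qed
next
  assume nH: "\<not> (\<exists>i \<in> {..<k}. x \<in> H i \<and> y \<in> H i)"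
  have xy: "x \<in> carrier R" "nonunit_coords x \<noteq> {}" "y \<in> carrier R" "nonunit_coords y \<noteq> {}"
    using x y by (auto simp: nonzero_zero_divisors_def zero_divisors_iff)
  have "\<exists>i \<in> nonunit_coords x. \<exists>j \<in> nonunit_coords y. i \<noteq> j \<or> k \<le> i"
  proof (rule ccontr)
    assume "\<not> ?thesis"
    then have eq: "i = j \<and> i < k" if "i \<in> nonunit_coords x" "j \<in> nonunit_coords y" for i j
      using that not_le by blast
    obtain i where "i \<in> nonunit_coords x" using xy by blast
    then have "nonunit_coords x = {i}" "nonunit_coords y = {i}" "i < k"
      using eq xy by blast+
    then show False using nH xy by (auto simp: H_eq)
  qed
  then obtain i j where ij: "i \<in> nonunit_coords x" "j \<in> nonunit_coords y" "i \<noteq> j \<or> k \<le> i"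
    by blast
  then have len: "i < length Rs" "j < length Rs" by (auto simp: nonunit_coords_def)
  obtain w where w: "w \<in> carrier R" "w \<noteq> \<zero>"
    "\<And>l. \<lbrakk>l < length Rs; l \<noteq> i\<rbrakk> \<Longrightarrow> \<phi> w ! l = \<zero>\<^bsub>Rs ! l\<^esub>"
    "\<And>v. \<lbrakk>v \<in> carrier R; i \<in> nonunit_coords v\<rbrakk> \<Longrightarrow> w \<otimes> v = \<zero>" "k \<le> i \<Longrightarrow> w \<otimes> w = \<zero>"
    using socle_element[OF len(1)] by blast
  have w_ann: "w \<in> ann R x - {\<zero>}" using w ij xy by (simp add: ann_def)
  show "\<exists>w \<in> ann R x - {\<zero>}. \<exists>z \<in> ann R y - {\<zero>}. w \<otimes> z = \<zero>"
  proof (cases "i = j")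
    case True
    then have "w \<in> ann R y - {\<zero>}" "w \<otimes> w = \<zero>" using w ij xy by (auto simp: ann_def)
    then show ?thesis using w_ann by blast
  next
    case False
    obtain z where z: "z \<in> carrier R" "z \<noteq> \<zero>"
      "\<And>l. \<lbrakk>l < length Rs; l \<noteq> j\<rbrakk> \<Longrightarrow> \<phi> z ! l = \<zero>\<^bsub>Rs ! l\<^esub>"
      "\<And>v. \<lbrakk>v \<in> carrier R; j \<in> nonunit_coords v\<rbrakk> \<Longrightarrow> z \<otimes> v = \<zero>" "k \<le> j \<Longrightarrow> z \<otimes> z = \<zero>"
      using socle_element[OF len(2)] by blast
    have "w \<otimes> z = \<zero>"
    proof -
      have "\<phi> w ! l \<otimes>\<^bsub>Rs ! l\<^esub> \<phi> z ! l = \<zero>\<^bsub>Rs ! l\<^esub>" if l: "l < length Rs" for l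
        using w(1) z(1) w(3)[OF l] z(3)[OF l] False l coord_carrier factor_l_null factor_r_null
        by (cases "l = i") auto
      then show ?thesis using w z by (simp add: mult_eq_zero_iff)
    qed
    moreover have "z \<in> ann R y - {\<zero>}" using z ij xy by (simp add: ann_def)
    ultimately show ?thesis using w_ann by blast
  qed
qed

lemma H_element:
  assumes i: "i < k" and u: "\<And>l. l < length Rs \<Longrightarrow> l \<noteq> i \<Longrightarrow> u l \<in> Units (Rs ! l)"
  obtains x where "x \<in> H i" "\<And>l. l < length Rs \<Longrightarrow> l \<noteq> i \<Longrightarrow> \<phi> x ! l = u l"
proof -
  have i': "i < length Rs" using i field_count by simp
  obtain x where x: "x \<in> carrier R"
    "\<And>l. l < length Rs \<Longrightarrow> \<phi> x ! l = (if l = i then \<zero>\<^bsub>Rs ! l\<^esub> else u l)"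
  proof (rule ex_coords)
    show "(if l = i then \<zero>\<^bsub>Rs ! l\<^esub> else u l) \<in> carrier (Rs ! l)" if "l < length Rs" for l
      using that u factor_zero_closed by (auto simp: Units_def)
  qed blast
  have "\<phi> x ! l \<notin> Units (Rs ! l) \<longleftrightarrow> l = i" if "l < length Rs" for l
    using that x(2)[OF that] u zero_not_unit by (cases "l = i") simp_all
  then have "nonunit_coords x = {i}"
    using i' by (auto simp: nonunit_coords_def)
  then show thesis using that[of x] x by (simp add: H_eq[OF i])
qed

lemma one_unit: "l < length Rs \<Longrightarrow> \<one>\<^bsub>Rs ! l\<^esub> \<in> Units (Rs ! l)"
proof -
  assume "l < length Rs"
  then interpret S: cring "Rs ! l" by (rule factor_cring)
  show ?thesis by simp
qed

lemma H_nonempty: "i < k \<Longrightarrow> H i \<noteq> {}"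
  by (metis H_element[of i "\<lambda>l. \<one>\<^bsub>Rs ! l\<^esub>"] one_unit empty_iff)

text \<open>
  With several field factors, another set \<open>H j\<close> lies outside \<open>H i\<close>. With a single one, there is a
  non-reduced factor, and a socle element there has square zero; so it would be adjacent to itself
  if loops were allowed, which no element of \<open>H i\<close> would be.
\<close>

lemma H_proper:
  assumes i: "i < k"
  shows "nonzero_zero_divisors R - H i \<noteq> {}"
proof (cases "k = 1")
  case False
  obtain j where j: "j < k" "j \<noteq> i"
  proof
    show "(if i = 0 then 1 else 0) < k" "(if i = 0 then 1 else 0) \<noteq> i"
      using False some_field by auto
  qed
  obtain x where "x \<in> H j" using H_nonempty[OF j(1)] by blast
  then show ?thesis using H_subset[OF j(1)] j i by (auto simp: H_eq)
next
  case True
  then have j: "1 < length Rs" "k \<le> 1" using two_factors by auto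
  obtain e where e: "e \<in> carrier R" "e \<noteq> \<zero>" "e \<otimes> e = \<zero>"
    by (rule socle_element[OF j(1)]) (use j(2) in blast)
  have "e \<in> nonzero_zero_divisors R"
    using e by (auto simp: nonzero_zero_divisors_def zero_divisors_def)
  moreover from this have "e \<notin> H i"
    using arc_iff[of e e] e i by (auto simp: ann_def)
  ultimately show ?thesis by blast
qed

lemma nontrivial_unit:
  assumes l: "l < length Rs" and big: "card (carrier (Rs ! l)) \<noteq> 2 \<or> k \<le> l"
  shows "\<exists>u \<in> Units (Rs ! l). u \<noteq> \<one>\<^bsub>Rs ! l\<^esub>"
proof (cases "l < k")
  case True
  interpret F: field "Rs ! l" using True by (rule factor_field)
  have "card {\<zero>\<^bsub>Rs ! l\<^esub>, \<one>\<^bsub>Rs ! l\<^esub>} = 2" by simp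
  then have "carrier (Rs ! l) \<noteq> {\<zero>\<^bsub>Rs ! l\<^esub>, \<one>\<^bsub>Rs ! l\<^esub>}" using big True by auto
  then obtain u where "u \<in> carrier (Rs ! l)" "u \<noteq> \<zero>\<^bsub>Rs ! l\<^esub>" "u \<noteq> \<one>\<^bsub>Rs ! l\<^esub>" by blast
  then show ?thesis using field_Units_iff[OF True] by blast
next
  case False
  then have loc: "local_cring (Rs ! l)" "\<not> reduced_ring (Rs ! l)" using factor_local l by auto
  interpret L: local_cring "Rs ! l" by (rule loc)
  obtain x where x: "x \<in> carrier (Rs ! l)" "x \<noteq> \<zero>\<^bsub>Rs ! l\<^esub>" "x \<notin> Units (Rs ! l)"
    using L.nonreduced_has_nonzero_nonunit[OF loc(2)] by blast
  have "\<one>\<^bsub>Rs ! l\<^esub> \<ominus>\<^bsub>Rs ! l\<^esub> x \<noteq> \<one>\<^bsub>Rs ! l\<^esub>"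
  proof
    assume "\<one>\<^bsub>Rs ! l\<^esub> \<ominus>\<^bsub>Rs ! l\<^esub> x = \<one>\<^bsub>Rs ! l\<^esub>"
    moreover have "x = \<one>\<^bsub>Rs ! l\<^esub> \<ominus>\<^bsub>Rs ! l\<^esub> (\<one>\<^bsub>Rs ! l\<^esub> \<ominus>\<^bsub>Rs ! l\<^esub> x)"
      using x(1) by algebra
    ultimately show False using x(2) by (simp add: L.r_right_minus_eq)
  qed
  then show ?thesis using L.one_minus_nonunit x by blast
qed

text \<open>
  A factor with two units enlarges every \<open>H j\<close> belonging to another coordinate. If the only field
  is the given factor of cardinality different from 2, a non-reduced factor serves instead, since
  there \<open>\<one> \<ominus> x\<close> is a unit for every non-unit \<open>x\<close>.
\<close>

lemma some_H_not_singleton: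
  assumes "\<exists>i<length Rs. card (carrier (Rs ! i)) \<noteq> 2"
  shows "\<exists>j<k. \<exists>x \<in> H j. \<exists>y \<in> H j. x \<noteq> y"
proof -
  obtain i where i: "i < length Rs" "card (carrier (Rs ! i)) \<noteq> 2" using assms by blast
  have "\<exists>j l. j < k \<and> l < length Rs \<and> l \<noteq> j \<and> (card (carrier (Rs ! l)) \<noteq> 2 \<or> k \<le> l)"
  proof (cases "i = 0")
    case False
    then show ?thesis using i some_field by (intro exI[of _ 0] exI[of _ i]) auto
  next
    case True
    show ?thesis
    proof (cases "k = 1")
      case True
      then show ?thesis using two_factors by (intro exI[of _ 0] exI[of _ 1]) auto
    next
      case False
      then show ?thesis using i some_field \<open>i = 0\<close> by (intro exI[of _ 1] exI[of _ i]) auto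
    qed
  qed
  then obtain j l where jl: "j < k" "l < length Rs" "l \<noteq> j"
    "card (carrier (Rs ! l)) \<noteq> 2 \<or> k \<le> l"
    by blast
  obtain u where u: "u \<in> Units (Rs ! l)" "u \<noteq> \<one>\<^bsub>Rs ! l\<^esub>"
    using nontrivial_unit[OF jl(2,4)] by blast
  obtain x where x: "x \<in> H j" "\<phi> x ! l = \<one>\<^bsub>Rs ! l\<^esub>"
    by (rule H_element[OF jl(1), of "\<lambda>m. \<one>\<^bsub>Rs ! m\<^esub>"]) (use one_unit jl in auto)
  obtain y where y: "y \<in> H j" "\<phi> y ! l = u"
    by (rule H_element[OF jl(1), of "\<lambda>m. if m = l then u else \<one>\<^bsub>Rs ! m\<^esub>"])
      (use one_unit jl u in auto)
  have "x \<noteq> y" using x y u by auto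
  then show ?thesis using x y jl by blast
qed


section \<open>The weakly zero-divisor graph is complete multipartite\<close>

abbreviation W\<Gamma> :: "'a pair_pre_digraph" where
  "W\<Gamma> \<equiv> weakly_zero_divisor_graph R"

lemma pverts_W\<Gamma>: "pverts W\<Gamma> = nonzero_zero_divisors R"
  by (simp add: weakly_zero_divisor_graph_def)

sublocale multipartite: multipartite_graph W\<Gamma> "{..<k}" H
proof
  show "parcs W\<Gamma> = {(x, y). x \<in> pverts W\<Gamma> \<and> y \<in> pverts W\<Gamma> \<and> x \<noteq> y \<and>
      \<not> (\<exists>i \<in> {..<k}. x \<in> H i \<and> y \<in> H i)}"
    using arc_iff by (auto simp only: weakly_zero_divisor_graph_def pair_pre_digraph.simps)
  show "H i \<subseteq> pverts W\<Gamma>" if "i \<in> {..<k}" for i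
    using that H_subset by (simp add: pverts_W\<Gamma>)
  show "H i \<inter> H j = {}" if "i \<in> {..<k}" "j \<in> {..<k}" "i \<noteq> j" for i j
    using that by (auto simp: H_eq)
  show "H i \<noteq> {}" if "i \<in> {..<k}" for i
    using that H_nonempty by simp
  show "pverts W\<Gamma> - H i \<noteq> {}" if "i \<in> {..<k}" for i
    using that H_proper unfolding pverts_W\<Gamma> by simp
  have "0 \<in> {..<k}" using some_field by simp
  then show "{..<k} \<noteq> {}" by blast
qed

lemma T_set_minimum_cut_set:
  assumes big: "\<exists>i<length Rs. card (carrier (Rs ! i)) \<noteq> 2" and i: "i \<in> T_set R Rs \<phi> k"
  shows "minimum_cut_set W\<Gamma> (nonzero_zero_divisors R - H i)"
proof -
  have i': "i < k" "\<And>j. j < k \<Longrightarrow> H j \<lesssim> H i" using i by (auto simp: T_set_def)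
  obtain j x y where j: "j < k" "x \<in> H j" "y \<in> H j" "x \<noteq> y"
    using some_H_not_singleton[OF big] by blast
  obtain f where "inj_on f (H j)" "f ` H j \<subseteq> H i"
    using i'(2)[OF j(1)] by (auto simp: lepoll_def)
  then have "f x \<in> H i" "f y \<in> H i" "f x \<noteq> f y" using j by (auto simp: inj_on_def)
  then show ?thesis
    using multipartite.minimum_cut_setI[of i] i' by (simp add: pverts_W\<Gamma>)
qed

lemma T_set_attains_theta_max:
  assumes fin: "finite (carrier R)"
  obtains i where "i \<in> T_set R Rs \<phi> k" "card (H i) = theta_max R Rs \<phi> k"
    "\<And>j. j < k \<Longrightarrow> card (H j) \<le> card (H i)"
proof -
  let ?C = "(\<lambda>i. card (H i)) ` {..<k}"
  have "card (H 0) \<in> ?C" using some_field by simp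
  then have "?C \<noteq> {}" by blast
  then have "theta_max R Rs \<phi> k \<in> ?C" unfolding theta_max_def by (intro Max_in) simp_all
  then obtain i where i: "i < k" "card (H i) = theta_max R Rs \<phi> k" by auto
  have le: "card (H j) \<le> card (H i)" if "j < k" for j
    using that unfolding i(2) theta_max_def by (intro Max_ge) simp_all
  have finH: "finite (H j)" for j
    using fin by (auto simp: H_set_def)
  have "i \<in> T_set R Rs \<phi> k"
    using i(1) le finH by (simp add: T_set_def lepoll_iff_card_le)
  with i le that show thesis by blast
qed

end


section \<open>Minimum cut-sets, connectivity and minimum degree\<close>

theorem theorem4p6:
  fixes R :: "('a, 'm) ring_scheme"
    and Rs :: "('b, 'c) ring_scheme list"
    and \<phi> :: "'a \<Rightarrow> 'b list"
    and k n :: nat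
  assumes "artinian_cring R"
    and "1 \<le> k" and "k \<le> n" and "2 \<le> n"
    and "length Rs = n"
    and "\<phi> \<in> ring_iso R (RDirProd_list Rs)"
    and "\<And>i. i < k \<Longrightarrow> field (Rs ! i)"
    and "\<And>j. k \<le> j \<Longrightarrow> j < n \<Longrightarrow>
      artinian_cring (Rs ! j) \<and> local_cring (Rs ! j) \<and> \<not> reduced_ring (Rs ! j)"
  shows "((\<exists>i<n. card (carrier (Rs ! i)) \<noteq> 2) \<longrightarrow>
      (\<forall>i \<in> T_set R Rs \<phi> k.
        minimum_cut_set (weakly_zero_divisor_graph R)
          (nonzero_zero_divisors R - H_set R Rs \<phi> k i))) \<and>
    (finite (carrier R) \<longrightarrow>
      ((\<exists>i<n. card (carrier (Rs ! i)) \<noteq> 2) \<longrightarrow>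
        vertex_connectivity (weakly_zero_divisor_graph R) =
          card (nonzero_zero_divisors R) - theta_max R Rs \<phi> k) \<and>
      card (nonzero_zero_divisors R) - theta_max R Rs \<phi> k =
        min_degree (weakly_zero_divisor_graph R))"
proof -
  interpret R: artinian_cring R by fact
  interpret field_local_product R Rs \<phi> k
    by (intro field_local_product.intro field_local_product_axioms.intro R.is_cring)
      (use assms in simp_all)
  let ?big = "\<exists>i<n. card (carrier (Rs ! i)) \<noteq> 2"
  have min_cut: "minimum_cut_set W\<Gamma> (nonzero_zero_divisors R - H i)"
    if "?big" "i \<in> T_set R Rs \<phi> k" for i
    using T_set_minimum_cut_set that \<open>length Rs = n\<close> by simp
  moreover have "(?big \<longrightarrow> vertex_connectivity W\<Gamma> =
        card (nonzero_zero_divisors R) - theta_max R Rs \<phi> k) \<and>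
      card (nonzero_zero_divisors R) - theta_max R Rs \<phi> k = min_degree W\<Gamma>"
    if fin: "finite (carrier R)"
  proof -
    have fin': "finite (nonzero_zero_divisors R)"
      using fin by (simp add: nonzero_zero_divisors_def zero_divisors_def)
    obtain i where i: "i \<in> T_set R Rs \<phi> k" "card (H i) = theta_max R Rs \<phi> k"
      "\<And>j. j < k \<Longrightarrow> card (H j) \<le> card (H i)"
      using T_set_attains_theta_max[OF fin] by blast
    have "i < k" using i(1) by (simp add: T_set_def)
    then have "card (nonzero_zero_divisors R - H i) =
        card (nonzero_zero_divisors R) - theta_max R Rs \<phi> k"
      using H_subset fin' i(2) by (metis card_Diff_subset finite_subset)
    moreover have "vertex_connectivity W\<Gamma> = card (nonzero_zero_divisors R - H i)" if "?big"
      using multipartite.vertex_connectivity_eq min_cut that i(1) fin' by (simp add: pverts_W\<Gamma>)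
    moreover have "min_degree W\<Gamma> = card (nonzero_zero_divisors R) - theta_max R Rs \<phi> k"
      using multipartite.min_degree_eq[of i] \<open>i < k\<close> i fin' by (simp add: pverts_W\<Gamma>)
    ultimately show ?thesis by simp
  qed
  ultimately show ?thesis by blast
qed

end
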